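(* Let $n\geq 4$ and $k$ be integers with $1 \leq k \leq n/2$. Then the expanding constant of the generalised Petersen graph $P(n,k)$ satisfies $$h(P(n,k)) < \sqrt{ \frac{24 \pi}{[n^{1/2}]-1}},$$ where $[x]$ denotes the integer part of $x$.
   Context: For positive integers $n \geq 3$ and $k \leq n/2$, the generalised Petersen graph $P(n,k)$ is the graph with vertex set $\{a_i, b_i : 0 \leq i \leq n-1\}$ (so $2n$ vertices) and edges $a_i a_{i+1}$, $a_i b_i$, $b_i b_{i+k}$ for $0 \leq i \leq n-1$, with subscripts read modulo $n$. When $k=n/2$, the edges $b_ib_{i+k}$ and $b_{i+k}b_{i+2k}=b_{i+k}b_i$ are counted separately, so that $b_i$ and $b_{i+k}$ are joined by a double edge. With this convention $P(n,k)$ is always connected and cubic ($3$-regular). The expanding constant of a finite graph $X$ with vertex set $V$ is $$h(X) = \min_{0 < |F| \leq |V|/2} \frac{|\partial F|}{|F|},$$ where $F$ ranges over the subsets of $V$ and $\partial F$ is the set of edges (counted with multiplicity) connecting a vertex in $F$ to a vertex not in $F$. *)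

theory Defs
  imports Complex_Main "HOL-Library.Multiset"
begin

text \<open>Undirected multigraphs: an edge is the two-element set of its endpoints,
  and parallel edges are recorded by multiplicity in the multiset of edges.\<close>

record 'a multigraph =
  verts :: "'a set"
  edges :: "'a set multiset"

definition edge_boundary :: "'a multigraph \<Rightarrow> 'a set \<Rightarrow> 'a set multiset" where
  "edge_boundary X F = {# e \<in># edges X. \<exists>u\<in>F. \<exists>v\<in>verts X - F. e = {u, v} #}"

definition expanding_constant :: "'a multigraph \<Rightarrow> real" where
  "expanding_constant X =
     Min {real (size (edge_boundary X F)) / real (card F) |F.
            F \<subseteq> verts X \<and> 0 < card F \<and> real (card F) \<le> real (card (verts X)) / 2}"

datatype petersen_vertex = Outer nat | Inner nat

text \<open>For \<open>k = n/2\<close> the indices \<open>i\<close> and \<open>i + k\<close> contribute the same set \<open>{Inner i, Inner (i + k)}\<close>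
  to the last summand, which therefore has multiplicity two.\<close>

definition petersen_graph :: "nat \<Rightarrow> nat \<Rightarrow> petersen_vertex multigraph" where
  "petersen_graph n k = \<lparr>
     verts = Outer ` {0..<n} \<union> Inner ` {0..<n},
     edges = image_mset (\<lambda>i. {Outer i, Outer ((i + 1) mod n)}) (mset_set {0..<n})
           + image_mset (\<lambda>i. {Outer i, Inner i}) (mset_set {0..<n})
           + image_mset (\<lambda>i. {Inner i, Inner ((i + k) mod n)}) (mset_set {0..<n}) \<rparr>"

end

theory Submission
  imports Defs "HOL-Number_Theory.Cong"
begin

text \<open>Let \<open>r = \<lfloor>\<lfloor>\<surd>n\<rfloor> / 2\<rfloor>\<close> and let \<open>f x\<close> count the pairs \<open>(a, b)\<close> with \<open>a, b < r\<close> and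
  \<open>a + b k \<equiv> x (mod n)\<close>. By telescoping, the total variation of \<open>f\<close> along each of the steps
  \<open>1\<close> and \<open>k\<close> is at most \<open>2 r\<close>, while \<open>f\<close> has total mass \<open>r\<^sup>2 \<le> n/2\<close>. The discrete coarea formula
  then yields a superlevel set \<open>S\<close> of \<open>f\<close> whose boundary has at most \<open>4 |S| / r\<close> edges. Taking
  all \<open>a\<^sub>i\<close> and \<open>b\<^sub>i\<close> with \<open>i \<in> S\<close> gives \<open>h \<le> 2 / r \<le> 4 / (\<lfloor>\<surd>n\<rfloor> - 1)\<close>.
  No case distinction on \<open>k\<close> is needed, since collisions between the \<open>a + b k\<close> are absorbed by
  the multiplicities.\<close>

section \<open>Cuts and lattice counts modulo \<open>n\<close>\<close>

text \<open>Cut edges of step \<open>d\<close> are recorded by their starting index. For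
  \<open>2 * d = n\<close> both \<open>i\<close> and \<open>i + d\<close> are recorded, which
  matches the double edge.\<close>

definition shift_boundary :: "nat \<Rightarrow> nat \<Rightarrow> nat set \<Rightarrow> nat set" where
  "shift_boundary n d S = {i \<in> {0..<n}. (i \<in> S) \<noteq> ((i + d) mod n \<in> S)}"

lemma finite_shift_boundary [simp]: "finite (shift_boundary n d S)"
  by (simp add: shift_boundary_def)

text \<open>Reducing \<open>x\<close> as well makes the count periodic, so it can be evaluated at
  \<open>x + p\<close> directly. General steps \<open>p\<close> and \<open>q\<close> make the two
  directions interchangeable.\<close>

definition grid_count :: "nat \<Rightarrow> nat \<Rightarrow> nat \<Rightarrow> nat \<Rightarrow> nat \<Rightarrow> nat" where
  "grid_count n r p q x = (\<Sum>a<r. \<Sum>b<r. of_bool ((a * p + b * q) mod n = x mod n))"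

lemma grid_count_commute: "grid_count n r p q x = grid_count n r q p x"
  unfolding grid_count_def by (subst sum.swap) (simp add: add.commute)

lemma grid_count_mod [simp]: "grid_count n r p q (x mod n) = grid_count n r p q x"
  by (simp add: grid_count_def)

text \<open>Translation by \<open>d\<close> permutes the residues, so exactly one \<open>x\<close>
  contributes.\<close>

lemma sum_of_bool_residue:
  fixes n c d :: nat
  assumes "0 < n"
  shows "(\<Sum>x = 0..<n. of_bool (c mod n = (x + d) mod n) :: int) = 1"
proof -
  have inj: "inj_on (\<lambda>x. (x + d) mod n) {0..<n}"
  proof (rule inj_onI)
    fix x y assume "x \<in> {0..<n}" "y \<in> {0..<n}" "(x + d) mod n = (y + d) mod n"
    then have "x mod n = y mod n"
      by (metis cong_add_rcancel_nat cong_def)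
    with \<open>x \<in> _\<close> \<open>y \<in> _\<close> show "x = y" by simp
  qed
  have img: "(\<lambda>x. (x + d) mod n) ` {0..<n} = {0..<n}"
    by (rule endo_inj_surj[OF _ _ inj]) (use assms in auto)
  have "(\<Sum>x = 0..<n. of_bool (c mod n = (x + d) mod n) :: int)
      = (\<Sum>y \<in> (\<lambda>x. (x + d) mod n) ` {0..<n}. of_bool (c mod n = y))"
    by (simp add: sum.reindex[OF inj])
  also have "\<dots> = 1"
    unfolding img using assms by (simp add: of_bool_def sum.delta')
  finally show ?thesis .
qed

lemma sum_grid_count:
  assumes "0 < n"
  shows "(\<Sum>x = 0..<n. int (grid_count n r p q x)) = int (r * r)"
proof -
  have "(\<Sum>x = 0..<n. int (grid_count n r p q x))
      = (\<Sum>x = 0..<n. \<Sum>a<r. \<Sum>b<r. of_bool ((a * p + b * q) mod n = (x + 0) mod n))"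
    by (simp add: grid_count_def)
  also have "\<dots> = (\<Sum>a<r. \<Sum>b<r. \<Sum>x = 0..<n. of_bool ((a * p + b * q) mod n = (x + 0) mod n))"
    by (subst sum.swap, rule sum.cong[OF refl], rule sum.swap)
  also have "\<dots> = int (r * r)"
    by (subst sum_of_bool_residue[OF assms]) simp
  finally show ?thesis .
qed

lemma grid_count_le: "grid_count n r p q x \<le> r * r"
proof -
  have "grid_count n r p q x \<le> (\<Sum>a<r. \<Sum>b<r. 1)"
    unfolding grid_count_def by (intro sum_mono) auto
  then show ?thesis by simp
qed

text \<open>Moving \<open>x\<close> by \<open>p\<close> amounts to moving \<open>a\<close> by one,
  so the sum over \<open>a\<close> telescopes and only the ends \<open>a = 0\<close> and
  \<open>a = r\<close> survive.\<close>

lemma grid_count_diff: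
  "int (grid_count n r p q (x + p)) - int (grid_count n r p q x)
    = (\<Sum>b<r. of_bool ((b * q) mod n = (x + p) mod n)
              - of_bool ((r * p + b * q) mod n = (x + p) mod n))"
proof -
  define h :: "nat \<Rightarrow> nat \<Rightarrow> int"
    where "h b a = of_bool ((a * p + b * q) mod n = (x + p) mod n)" for a b
  have step: "of_bool ((a * p + b * q) mod n = x mod n) = h b (Suc a)" for a b
  proof -
    have "(a * p + b * q) mod n = x mod n \<longleftrightarrow> (a * p + b * q + p) mod n = (x + p) mod n"
      by (metis cong_add_rcancel_nat cong_def)
    then show ?thesis by (simp add: h_def algebra_simps)
  qed
  have "int (grid_count n r p q (x + p)) - int (grid_count n r p q x)
      = (\<Sum>a<r. \<Sum>b<r. h b a) - (\<Sum>a<r. \<Sum>b<r. h b (Suc a))"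
    by (simp only: grid_count_def of_nat_sum of_nat_of_bool step) (simp only: h_def)
  also have "\<dots> = (\<Sum>b<r. \<Sum>a<r. h b a - h b (Suc a))"
    by (subst (1 2) sum.swap) (simp add: sum_subtractf)
  also have "\<dots> = (\<Sum>b<r. h b 0 - h b r)"
    by (simp add: sum_lessThan_telescope')
  finally show ?thesis by (simp add: h_def)
qed

text \<open>The triangle inequality leaves \<open>2 * r\<close> indicators, each of which is met by
  exactly one \<open>x\<close>.\<close>

lemma grid_count_variation:
  assumes "0 < n"
  shows "(\<Sum>x = 0..<n. \<bar>int (grid_count n r p q x) - int (grid_count n r p q (x + p))\<bar>) \<le> 2 * int r"
proof -
  have "(\<Sum>x = 0..<n. \<bar>int (grid_count n r p q x) - int (grid_count n r p q (x + p))\<bar>)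
     \<le> (\<Sum>x = 0..<n. \<Sum>b<r. of_bool ((b * q) mod n = (x + p) mod n)
              + of_bool ((r * p + b * q) mod n = (x + p) mod n))"
    by (intro sum_mono, subst abs_minus_commute, unfold grid_count_diff,
        rule order_trans[OF sum_abs], rule sum_mono) auto
  also have "\<dots> = (\<Sum>b<r. (\<Sum>x = 0..<n. of_bool ((b * q) mod n = (x + p) mod n))
              + (\<Sum>x = 0..<n. of_bool ((r * p + b * q) mod n = (x + p) mod n)))"
    by (subst sum.swap) (simp add: sum.distrib)
  also have "\<dots> = 2 * int r"
    by (subst (1 2) sum_of_bool_residue[OF assms]) simp
  finally show ?thesis .
qed

section \<open>Superlevel sets and the coarea formula\<close>

lemma sum_of_bool_levels:
  fixes y M :: nat
  assumes "y \<le> M"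
  shows "(\<Sum>j = 1..M. of_bool (j \<le> y) :: int) = int y"
proof -
  have "{1..M} \<inter> {j. j \<le> y} = {1..y}" using assms by auto
  then show ?thesis by (simp add: sum_of_bool_eq)
qed

lemma sum_of_bool_levels_diff:
  fixes y z M :: nat
  assumes "y \<le> M" "z \<le> M"
  shows "(\<Sum>j = 1..M. of_bool ((j \<le> y) \<noteq> (j \<le> z)) :: int) = \<bar>int y - int z\<bar>"
proof -
  have *: "(\<Sum>j = 1..M. of_bool ((j \<le> y) \<noteq> (j \<le> z)) :: int) = int y - int z"
    if "z \<le> y" "y \<le> M" for y z
  proof -
    have "(\<Sum>j = 1..M. of_bool ((j \<le> y) \<noteq> (j \<le> z)) :: int)
        = (\<Sum>j = 1..M. of_bool (j \<le> y) - of_bool (j \<le> z))"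
      using that by (intro sum.cong) auto
    then show ?thesis
      using that sum_of_bool_levels[of y M] sum_of_bool_levels[of z M] by (simp add: sum_subtractf)
  qed
  show ?thesis
  proof (cases "z \<le> y")
    case True
    then show ?thesis using *[of z y] assms by simp
  next
    case False
    then have "(\<Sum>j = 1..M. of_bool ((j \<le> z) \<noteq> (j \<le> y)) :: int) = int z - int y"
      using *[of y z] assms by simp
    moreover have "((j \<le> z) \<noteq> (j \<le> y)) = ((j \<le> y) \<noteq> (j \<le> z))" for j by blast
    ultimately show ?thesis using False by simp
  qed
qed

lemma sum_card_superlevel:
  fixes f :: "nat \<Rightarrow> nat"
  assumes "\<And>x. f x \<le> M"
  shows "(\<Sum>j = 1..M. int (card {x \<in> {0..<n}. j \<le> f x})) = (\<Sum>x = 0..<n. int (f x))"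
proof -
  have "(\<Sum>j = 1..M. int (card {x \<in> {0..<n}. j \<le> f x}))
      = (\<Sum>j = 1..M. \<Sum>x = 0..<n. of_bool (j \<le> f x))"
    by (intro sum.cong refl) (simp add: sum_of_bool_eq Int_def)
  also have "\<dots> = (\<Sum>x = 0..<n. \<Sum>j = 1..M. of_bool (j \<le> f x))"
    by (rule sum.swap)
  finally show ?thesis by (simp only: sum_of_bool_levels[OF assms])
qed

text \<open>The step from \<open>x\<close> to \<open>x + d\<close> is cut at exactly those levels
  \<open>j\<close> that separate the two values of \<open>f\<close>; their number is the absolute
  difference. Then the two sums are exchanged.\<close>

lemma discrete_coarea:
  fixes f :: "nat \<Rightarrow> nat"
  assumes "\<And>x. f x \<le> M"
  shows "(\<Sum>j = 1..M. int (card (shift_boundary n d {x \<in> {0..<n}. j \<le> f x})))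
       = (\<Sum>x = 0..<n. \<bar>int (f x) - int (f ((x + d) mod n))\<bar>)"
proof -
  have "(\<Sum>j = 1..M. int (card (shift_boundary n d {x \<in> {0..<n}. j \<le> f x})))
      = (\<Sum>j = 1..M. \<Sum>x = 0..<n. of_bool ((j \<le> f x) \<noteq> (j \<le> f ((x + d) mod n))))"
  proof (intro sum.cong refl)
    fix j
    have "shift_boundary n d {x \<in> {0..<n}. j \<le> f x}
        = {0..<n} \<inter> {x. (j \<le> f x) \<noteq> (j \<le> f ((x + d) mod n))}"
      by (auto simp: shift_boundary_def)
    then show "int (card (shift_boundary n d {x \<in> {0..<n}. j \<le> f x}))
        = (\<Sum>x = 0..<n. of_bool ((j \<le> f x) \<noteq> (j \<le> f ((x + d) mod n))))"
      by (simp only: sum_of_bool_eq finite_atLeastLessThan)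
  qed
  also have "\<dots> = (\<Sum>x = 0..<n. \<Sum>j = 1..M. of_bool ((j \<le> f x) \<noteq> (j \<le> f ((x + d) mod n))))"
    by (rule sum.swap)
  finally show ?thesis by (simp only: sum_of_bool_levels_diff[OF assms assms])
qed

section \<open>Choosing a good level by averaging\<close>

text \<open>If every nonempty superlevel set violated the bound, summing over all levels would turn
  the mass \<open>r * r\<close> and the total variation \<open>4 * r\<close> into
  \<open>4 * r * r < r * (4 * r)\<close>.\<close>

lemma exists_small_shift_boundary:
  assumes "0 < r" "2 * (r * r) \<le> n"
  shows "\<exists>S \<subseteq> {0..<n}. S \<noteq> {} \<and> 2 * card S \<le> n \<and>
    r * (card (shift_boundary n p S) + card (shift_boundary n q S)) \<le> 4 * card S"
proof (rule ccontr)
  assume contra: "\<not> ?thesis"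
  have "0 < r * r" using assms by simp
  then have n: "0 < n" using assms by linarith
  define f where "f = grid_count n r p q"
  define L where "L j = {x \<in> {0..<n}. j \<le> f x}" for j
  define B where "B j = card (shift_boundary n p (L j)) + card (shift_boundary n q (L j))" for j
  have f_le: "f x \<le> r * r" for x by (simp add: f_def grid_count_le)
  have mass: "(\<Sum>j = 1..r * r. int (card (L j))) = int (r * r)"
    unfolding L_def by (simp only: sum_card_superlevel[OF f_le]) (simp only: f_def sum_grid_count[OF n])
  have "(\<Sum>j = 1..r * r. int (card (shift_boundary n p (L j)))) \<le> 2 * int r"
    unfolding L_def discrete_coarea[OF f_le]
    using grid_count_variation[OF n, of r p q] by (simp add: f_def)
  moreover have "(\<Sum>j = 1..r * r. int (card (shift_boundary n q (L j)))) \<le> 2 * int r"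
    unfolding L_def discrete_coarea[OF f_le]
    using grid_count_variation[OF n, of r q p] by (simp add: f_def grid_count_commute[of n r p q])
  ultimately have bd: "(\<Sum>j = 1..r * r. int (B j)) \<le> 4 * int r"
    by (simp add: B_def sum.distrib)
  \<comment> \<open>A single level set is no larger than the total mass
    \<open>r * r\<close>.\<close>
  have half: "2 * card (L j) \<le> n" if "j \<in> {1..r * r}" for j
  proof -
    have "int (card (L j)) \<le> (\<Sum>j = 1..r * r. int (card (L j)))"
      using that by (intro member_le_sum) auto
    then show ?thesis using mass assms by linarith
  qed
  have less: "4 * int (card (L j)) < int r * int (B j)" if "j \<in> {1..r * r}" "L j \<noteq> {}" for j
  proof -
    have "L j \<subseteq> {0..<n}" by (auto simp: L_def)
    then have "4 * card (L j) < r * B j"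
      using contra half[OF that(1)] that(2) unfolding B_def by (meson not_le)
    then have "int (4 * card (L j)) < int (r * B j)" by (simp only: of_nat_less_iff)
    then show ?thesis by simp
  qed
  \<comment> \<open>Empty levels satisfy only the weak inequality, so strictness of the sum requires
    one nonempty level.\<close>
  have "\<exists>j \<in> {1..r * r}. L j \<noteq> {}"
  proof (rule ccontr)
    assume "\<not> ?thesis"
    then have "(\<Sum>j = 1..r * r. int (card (L j))) = 0" by simp
    with mass \<open>0 < r * r\<close> show False by linarith
  qed
  then have "(\<Sum>j = 1..r * r. 4 * int (card (L j))) < (\<Sum>j = 1..r * r. int r * int (B j))"
    using less by (intro sum_strict_mono_ex1) (force simp: less_imp_le)+
  then have "4 * int (r * r) < int r * (\<Sum>j = 1..r * r. int (B j))"
    by (simp only: sum_distrib_left[symmetric] mass)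
  also have "\<dots> \<le> int r * (4 * int r)" using bd by (intro mult_left_mono) auto
  finally show False by simp
qed

section \<open>From sets of indices to the Petersen graph\<close>

text \<open>Since \<open>F\<close> holds both copies of each index in \<open>S\<close>, no spoke is
  cut. Counting the remaining edges by index respects multiplicities.\<close>

lemma size_petersen_edge_boundary_le:
  fixes S :: "nat set"
  defines "F \<equiv> Outer ` S \<union> Inner ` S"
  shows "size (edge_boundary (petersen_graph n k) F)
    \<le> card (shift_boundary n 1 S) + card (shift_boundary n k S)"
proof -
  have size_le: "size {# e \<in># image_mset g (mset_set {0..<n}). P e #} \<le> card T"
    if "\<And>i. i < n \<Longrightarrow> P (g i) \<Longrightarrow> i \<in> T" "finite T"
    for g :: "nat \<Rightarrow> petersen_vertex set" and P T
  proof -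
    have "size {# e \<in># image_mset g (mset_set {0..<n}). P e #} = card {i \<in> {0..<n}. P (g i)}"
      by (simp add: filter_mset_image_mset filter_mset_mset_set)
    also have "\<dots> \<le> card T" using that by (intro card_mono) auto
    finally show ?thesis .
  qed
  define P where "P e \<longleftrightarrow> (\<exists>u\<in>F. \<exists>v\<in>verts (petersen_graph n k) - F. e = {u, v})" for e
  have "size {# e \<in># image_mset (\<lambda>i. {Outer i, Outer ((i + 1) mod n)}) (mset_set {0..<n}). P e #}
      \<le> card (shift_boundary n 1 S)"
    by (rule size_le) (auto simp: P_def F_def shift_boundary_def doubleton_eq_iff)
  moreover have "size {# e \<in># image_mset (\<lambda>i. {Outer i, Inner i}) (mset_set {0..<n}). P e #}
      \<le> card ({} :: nat set)"
    by (rule size_le) (auto simp: P_def F_def doubleton_eq_iff)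
  moreover have "size {# e \<in># image_mset (\<lambda>i. {Inner i, Inner ((i + k) mod n)}) (mset_set {0..<n}). P e #}
      \<le> card (shift_boundary n k S)"
    by (rule size_le) (auto simp: P_def F_def shift_boundary_def doubleton_eq_iff)
  moreover have "edge_boundary (petersen_graph n k) F = {# e \<in># edges (petersen_graph n k). P e #}"
    by (simp add: edge_boundary_def P_def)
  ultimately show ?thesis
    by (simp only: petersen_graph_def multigraph.simps filter_union_mset size_union card.empty)
qed

lemma expanding_constant_le:
  assumes "finite (verts X)" "F \<subseteq> verts X" "0 < card F" "2 * card F \<le> card (verts X)"
  shows "expanding_constant X \<le> real (size (edge_boundary X F)) / real (card F)"
  unfolding expanding_constant_def
proof (rule Min_le)
  have "{real (size (edge_boundary X F)) / real (card F) |F.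
            F \<subseteq> verts X \<and> 0 < card F \<and> real (card F) \<le> real (card (verts X)) / 2}
      \<subseteq> (\<lambda>F. real (size (edge_boundary X F)) / real (card F)) ` Pow (verts X)"
    by auto
  then show "finite {real (size (edge_boundary X F)) / real (card F) |F.
            F \<subseteq> verts X \<and> 0 < card F \<and> real (card F) \<le> real (card (verts X)) / 2}"
    using assms(1) by (auto intro: finite_subset)
  have "real (card F) \<le> real (card (verts X)) / 2" using assms(4) by linarith
  with assms show "real (size (edge_boundary X F)) / real (card F) \<in>
      {real (size (edge_boundary X F)) / real (card F) |F.
            F \<subseteq> verts X \<and> 0 < card F \<and> real (card F) \<le> real (card (verts X)) / 2}"
    by blast
qed

lemma card_Outer_Un_Inner:
  assumes "finite S"
  shows "card (Outer ` S \<union> Inner ` S) = 2 * card S"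
proof -
  have "card (Outer ` S \<union> Inner ` S) = card (Outer ` S) + card (Inner ` S)"
    using assms by (intro card_Un_disjoint) auto
  then show ?thesis by (simp add: card_image inj_on_def)
qed

text \<open>Doubling \<open>S\<close> doubles the cardinality but adds no cut edges beyond those of
  the two steps, so the ratio \<open>4 / r\<close> is halved.\<close>

lemma expanding_constant_petersen_le:
  assumes "0 < r" "2 * (r * r) \<le> n"
  shows "expanding_constant (petersen_graph n k) \<le> 2 / real r"
proof -
  obtain S where S: "S \<subseteq> {0..<n}" "S \<noteq> {}" "2 * card S \<le> n"
    and bd: "r * (card (shift_boundary n 1 S) + card (shift_boundary n k S)) \<le> 4 * card S"
    using exists_small_shift_boundary[OF assms, of 1 k] by (elim exE conjE)
  have fin: "finite S" using S(1) finite_subset by blast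
  then have pos: "0 < card S" using S(2) by (simp add: card_gt_0_iff)
  define F where "F = Outer ` S \<union> Inner ` S"
  define e where "e = size (edge_boundary (petersen_graph n k) F)"
  have cardF: "card F = 2 * card S" unfolding F_def by (rule card_Outer_Un_Inner[OF fin])
  have verts: "verts (petersen_graph n k) = Outer ` {0..<n} \<union> Inner ` {0..<n}"
    by (simp add: petersen_graph_def)
  have "r * e \<le> r * (card (shift_boundary n 1 S) + card (shift_boundary n k S))"
    unfolding e_def F_def by (intro mult_left_mono size_petersen_edge_boundary_le) simp
  then have "real (r * e) \<le> real (4 * card S)" using bd by linarith
  then have "real e / real (card F) \<le> 2 / real r"
    using pos assms(1) by (simp add: cardF field_simps)
  moreover have "expanding_constant (petersen_graph n k) \<le> real e / real (card F)"
    unfolding e_def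
  proof (rule expanding_constant_le)
    show "finite (verts (petersen_graph n k))" by (simp add: verts)
    show "F \<subseteq> verts (petersen_graph n k)" using S(1) by (auto simp: F_def verts)
    show "0 < card F" using pos by (simp add: cardF)
    show "2 * card F \<le> card (verts (petersen_graph n k))"
      using S(3) by (simp add: verts cardF card_Outer_Un_Inner)
  qed
  ultimately show ?thesis by linarith
qed

theorem corollary2p6:
  fixes n k :: nat
  assumes "4 \<le> n" and "1 \<le> k" and "real k \<le> real n / 2"
  shows "expanding_constant (petersen_graph n k)
           < sqrt (24 * pi / (real_of_int \<lfloor>sqrt (real n)\<rfloor> - 1))"
proof -
  define m where "m = nat \<lfloor>sqrt (real n)\<rfloor>"
  have m: "real_of_int \<lfloor>sqrt (real n)\<rfloor> = real m" by (simp add: m_def)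
  have "2 \<le> sqrt (real n)" using assms(1) by (intro real_le_rsqrt) simp
  then have m2: "2 \<le> m" by (simp add: m_def le_nat_iff le_floor_iff)
  have "real m \<le> sqrt (real n)" using m of_int_floor_le[of "sqrt (real n)"] by simp
  then have "(real m)\<^sup>2 \<le> real n" by (metis of_nat_0_le_iff power_mono real_sqrt_pow2)
  then have mn: "m * m \<le> n" by (simp add: power2_eq_square flip: of_nat_mult)
  \<comment> \<open>This gives \<open>4 * (r * r) \<le> m * m \<le> n\<close>, with room to spare,
    and \<open>m \<ge> 2\<close> keeps \<open>r\<close> positive.\<close>
  define r where "r = m div 2"
  have r: "0 < r" "2 * r \<le> m" "m \<le> 2 * r + 1" using m2 by (auto simp: r_def)
  have "(2 * r) * (2 * r) \<le> m * m" using r(2) by (rule mult_le_mono) (rule r(2))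
  then have "2 * (r * r) \<le> n" using mn by linarith
  then have "expanding_constant (petersen_graph n k) \<le> 2 / real r"
    by (rule expanding_constant_petersen_le[OF r(1)])
  \<comment> \<open>Rounding in \<open>m div 2\<close> loses at most one:
    \<open>m - 1 \<le> 2 * r\<close>.\<close>
  also have "\<dots> \<le> 4 / (real m - 1)"
    using r m2 by (simp add: field_simps)
  also have "\<dots> < sqrt (24 * pi / (real m - 1))"
  proof (rule real_less_rsqrt)
    define t where "t = real m - 1"
    have t: "1 \<le> t" using m2 by (simp add: t_def)
    \<comment> \<open>After squaring and clearing denominators the claim reads
      \<open>16 < 24 * pi * t\<close>, where \<open>t \<ge> 1\<close>.\<close>
    have "16 < 24 * pi" using pi_ge_two by linarith
    also have "\<dots> \<le> 24 * pi * t" using t by simp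
    finally have "(4 / t)\<^sup>2 < 24 * pi / t"
      using t by (simp add: field_simps power2_eq_square)
    then show "(4 / (real m - 1))\<^sup>2 < 24 * pi / (real m - 1)" by (simp only: t_def)
  qed
  finally show ?thesis unfolding m .
qed

end
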